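(* Let $R$ be a commutative ring with identity whose Jacobson radical is zero, and let $\mathrm{X}(R)$ be a spectrum of $R$ that contains all maximal ideals of $R$. If the closed subbase $\mathcal{S}_{\mathrm{h}}=\{\mathrm{h}(\mathfrak{a})\mid \mathfrak{a}\in\mathrm{Idl}(R)\}$ strongly disconnects the ideal space $\mathrm{X}(R)$, then $R$ has a non-trivial idempotent element.
   Context: $\mathrm{Idl}(R)$ is the set of all ideals of $R$. A spectrum $\mathrm{X}(R)$ of $R$ is an arbitrary class (set) of ideals of $R$ with $R\notin \mathrm{X}(R)$. For $\mathfrak{a}\in\mathrm{Idl}(R)$ put $\mathrm{h}(\mathfrak{a})=\{\mathfrak{s}\in \mathrm{X}(R)\mid \mathfrak{a}\subseteq \mathfrak{s}\}$. The ideal space $\mathrm{X}(R)$ is the set $\mathrm{X}(R)$ with the topology having $\mathcal{S}_{\mathrm{h}}$ as a closed subbase. A closed subbase $\mathcal{S}$ of a topological space $Y$ strongly disconnects $Y$ if there exist non-empty $A,B\in\mathcal{S}$ with $Y=A\cup B$ and $A\cap B=\emptyset$. A non-trivial idempotent is an idempotent element different from $0$ and $1$. *)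

theory Defs
  imports "HOL-Algebra.Ideal" "HOL-Analysis.Abstract_Topology"
begin

definition ideals :: "('a, 'm) ring_scheme \<Rightarrow> 'a set set"
  where "ideals R = {\<aa>. ideal \<aa> R}"

definition max_ideals :: "('a, 'm) ring_scheme \<Rightarrow> 'a set set"
  where "max_ideals R = {\<mm>. maximalideal \<mm> R}"

(* The intersection is taken inside the carrier, so a ring without maximal
   ideals (the zero ring) is its own Jacobson radical. *)
definition jacobson_radical :: "('a, 'm) ring_scheme \<Rightarrow> 'a set"
  where "jacobson_radical R = carrier R \<inter> \<Inter>(max_ideals R)"

definition spectrum :: "('a, 'm) ring_scheme \<Rightarrow> 'a set set \<Rightarrow> bool"
  where "spectrum R X \<longleftrightarrow> X \<subseteq> ideals R \<and> carrier R \<notin> X"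

definition ideal_hull :: "'a set set \<Rightarrow> 'a set \<Rightarrow> 'a set set"
  where "ideal_hull X \<aa> = {\<ss> \<in> X. \<aa> \<subseteq> \<ss>}"

definition ideal_hulls :: "('a, 'm) ring_scheme \<Rightarrow> 'a set set \<Rightarrow> 'a set set set"
  where "ideal_hulls R X = {ideal_hull X \<aa> |\<aa>. \<aa> \<in> ideals R}"

(* The open sets are the unions of finite intersections, formed inside U, of
   complements U - C with C in S; the empty intersection is U itself. *)
definition closed_subbase_topology :: "'p set \<Rightarrow> 'p set set \<Rightarrow> 'p topology"
  where "closed_subbase_topology U S =
    topology (arbitrary union_of (finite intersection_of (\<lambda>V. \<exists>C\<in>S. V = U - C) relative_to U))"

definition closed_subbase :: "'p topology \<Rightarrow> 'p set set \<Rightarrow> bool"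
  where "closed_subbase Y S \<longleftrightarrow>
    S \<subseteq> Pow (topspace Y) \<and> Y = closed_subbase_topology (topspace Y) S"

definition strongly_disconnects :: "'p set set \<Rightarrow> 'p topology \<Rightarrow> bool"
  where "strongly_disconnects S Y \<longleftrightarrow> closed_subbase Y S \<and>
    (\<exists>A\<in>S. \<exists>B\<in>S. A \<noteq> {} \<and> B \<noteq> {} \<and> topspace Y = A \<union> B \<and> A \<inter> B = {})"

definition ideal_space :: "('a, 'm) ring_scheme \<Rightarrow> 'a set set \<Rightarrow> 'a set topology"
  where "ideal_space R X = closed_subbase_topology X (ideal_hulls R X)"

definition nontrivial_idempotent :: "('a, 'm) ring_scheme \<Rightarrow> 'a \<Rightarrow> bool"
  where "nontrivial_idempotent R e \<longleftrightarrow>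
    e \<in> carrier R \<and> e \<otimes>\<^bsub>R\<^esub> e = e \<and> e \<noteq> \<zero>\<^bsub>R\<^esub> \<and> e \<noteq> \<one>\<^bsub>R\<^esub>"

lemma topspace_closed_subbase_topology [simp]: "topspace (closed_subbase_topology U S) = U"
  unfolding closed_subbase_topology_def by (rule topspace_subbase)

lemma closedin_closed_subbase_topology:
  assumes "C \<in> S" "C \<subseteq> U"
  shows "closedin (closed_subbase_topology U S) C"
proof -
  have "openin (closed_subbase_topology U S) (U \<inter> (U - C))"
    unfolding closed_subbase_topology_def openin_subbase
    using assms(1)
    by (intro union_of_inc relative_to_inc intersection_of_inc) (auto simp: arbitrary_def)
  moreover have "U \<inter> (U - C) = U - C" by auto
  ultimately show ?thesis
    using assms(2) by (simp add: closedin_def)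
qed

lemma topspace_ideal_space [simp]: "topspace (ideal_space R X) = X"
  by (simp add: ideal_space_def)

lemma closed_subbase_ideal_space: "closed_subbase (ideal_space R X) (ideal_hulls R X)"
  by (auto simp: closed_subbase_def ideal_space_def ideal_hulls_def ideal_hull_def)

end

theory Submission
  imports Defs "HOL-Algebra.Ring_Divisibility"
begin

text \<open>
  Let \<open>h(\<aa>)\<close> and \<open>h(\<bb>)\<close> be the two disjoint non-empty hulls covering \<open>X\<close>. Since \<open>X\<close> contains the
  maximal ideals, disjointness says that no maximal ideal contains both \<open>\<aa>\<close> and \<open>\<bb>\<close>; so
  \<open>\<aa> + \<bb> = R\<close> by Krull's theorem, and \<open>\<one> = e + f\<close> with \<open>e \<in> \<aa>\<close> and \<open>f \<in> \<bb>\<close>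
  (\<open>comaximal_if_no_common_maximalideal\<close>).
  Covering says that every maximal ideal contains \<open>\<aa>\<close> or \<open>\<bb>\<close>, hence contains \<open>e f\<close>; so \<open>e f\<close> lies in
  the Jacobson radical and vanishes (\<open>mult_in_jacobson_radical\<close>). Multiplying \<open>\<one> = e + f\<close> by \<open>e\<close>
  gives \<open>e\<^sup>2 = e\<close>. Finally, the hulls are non-empty and consist of proper ideals, so \<open>\<aa>\<close> and \<open>\<bb>\<close> are
  proper; thus \<open>e \<noteq> \<one>\<close> and \<open>f \<noteq> \<one>\<close>, the latter being \<open>e \<noteq> \<zero>\<close>.
\<close>

text \<open>
  Krull's theorem. Zorn's lemma applies because a proper ideal is one that avoids \<open>\<one>\<close>, a property
  inherited by unions of chains.
\<close>

lemma (in ring) proper_ideal_imp_maximalideal: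
  assumes I: "ideal I R" and proper: "I \<noteq> carrier R"
  obtains M where "maximalideal M R" "I \<subseteq> M"
proof -
  define \<A> where "\<A> = {J. ideal J R \<and> I \<subseteq> J \<and> \<one> \<notin> J}"
  have "I \<in> \<A>"
    using I proper ideal.one_imp_carrier unfolding \<A>_def by blast
  have "\<Union>C \<in> \<A>" if "C \<noteq> {}" "subset.chain \<A> C" for C
  proof -
    have "subset.chain {J. ideal J R} C"
      using that(2) unfolding \<A>_def pred_on.chain_def by blast
    then have "ideal (\<Union>C) R"
      using chain_Union_is_ideal[of C] that(1) by simp
    then show ?thesis
      using that unfolding \<A>_def pred_on.chain_def by blast
  qed
  then obtain M where M: "M \<in> \<A>" and max: "\<And>J. J \<in> \<A> \<Longrightarrow> M \<subseteq> J \<Longrightarrow> J = M"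
    using subset_Zorn_nonempty[of \<A>] \<open>I \<in> \<A>\<close> by blast
  have "maximalideal M R"
  proof (rule maximalidealI)
    show "ideal M R" and "carrier R \<noteq> M"
      using M unfolding \<A>_def by auto
    show "J = M \<or> J = carrier R" if "ideal J R" "M \<subseteq> J" for J
      using that M max[of J] ideal.one_imp_carrier[of J R] unfolding \<A>_def by blast
  qed
  with M show thesis
    using that unfolding \<A>_def by blast
qed

text \<open>
  A maximal ideal above \<open>I + J\<close> would contain both summands, so \<open>I + J\<close> cannot be proper.
\<close>

lemma (in ring) comaximal_if_no_common_maximalideal:
  assumes I: "ideal I R" and J: "ideal J R"
    and no_common: "\<And>M. maximalideal M R \<Longrightarrow> I \<subseteq> M \<Longrightarrow> J \<subseteq> M \<Longrightarrow> False"
  obtains x y where "x \<in> I" "y \<in> J" "\<one> = x \<oplus> y"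
proof -
  have "I <+>\<^bsub>R\<^esub> J = carrier R"
  proof (rule ccontr)
    assume "I <+>\<^bsub>R\<^esub> J \<noteq> carrier R"
    then obtain M where M: "maximalideal M R" "I <+>\<^bsub>R\<^esub> J \<subseteq> M"
      using proper_ideal_imp_maximalideal[OF add_ideals[OF I J]] by blast
    have "I \<union> J \<subseteq> carrier R"
      using ideal.Icarr[OF I] ideal.Icarr[OF J] by auto
    then have "I \<union> J \<subseteq> I <+>\<^bsub>R\<^esub> J"
      unfolding union_genideal[OF I J, symmetric] by (rule genideal_self)
    with M no_common show False
      by blast
  qed
  then have "\<one> \<in> I <+>\<^bsub>R\<^esub> J"
    by simp
  then show thesis
    using that unfolding set_add_def' by blast
qed

text \<open>
  Each maximal ideal holds one of the two factors and absorbs multiples; which factor it is may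
  change from one maximal ideal to the next.
\<close>

lemma mult_in_jacobson_radical:
  fixes R (structure)
  assumes I: "ideal I R" and J: "ideal J R" and x: "x \<in> I" and y: "y \<in> J"
    and covered: "\<And>M. maximalideal M R \<Longrightarrow> I \<subseteq> M \<or> J \<subseteq> M"
  shows "x \<otimes> y \<in> jacobson_radical R"
proof -
  interpret I: ideal I R by (fact I)
  have carr: "x \<in> carrier R" "y \<in> carrier R"
    using I J x y ideal.Icarr by metis+
  have "x \<otimes> y \<in> M" if M: "maximalideal M R" for M
  proof -
    interpret M: maximalideal M R by (fact M)
    show ?thesis
      using covered[OF M] x y carr M.I_l_closed M.I_r_closed by blast
  qed
  with carr show ?thesis
    by (simp add: jacobson_radical_def max_ideals_def)
qed

lemma one_notin_ideal_if_hull_nonempty: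
  assumes "spectrum R X" and "ideal_hull X I \<noteq> {}"
  shows "\<one>\<^bsub>R\<^esub> \<notin> I"
proof
  assume one: "\<one>\<^bsub>R\<^esub> \<in> I"
  obtain P where "P \<in> X" "I \<subseteq> P"
    using assms(2) unfolding ideal_hull_def by blast
  with one assms(1) have "ideal P R" "\<one>\<^bsub>R\<^esub> \<in> P" "P \<noteq> carrier R"
    unfolding spectrum_def ideals_def by auto
  then show False
    using ideal.one_imp_carrier by blast
qed

lemma (in ring) complementary_orthogonal_imp_idempotent:
  assumes "x \<in> carrier R" "y \<in> carrier R" "\<one> = x \<oplus> y" "x \<otimes> y = \<zero>"
  shows "x \<otimes> x = x"
proof -
  have "x = x \<otimes> (x \<oplus> y)"
    using assms(1,3) r_one by metis
  also have "\<dots> = x \<otimes> x"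
    using assms(1,2,4) by (simp add: r_distr)
  finally show ?thesis ..
qed

theorem proposition3p24:
  fixes R :: "('a, 'm) ring_scheme" and X :: "'a set set"
  assumes "cring R"
    and "jacobson_radical R = {\<zero>\<^bsub>R\<^esub>}"
    and "spectrum R X"
    and "max_ideals R \<subseteq> X"
    and "strongly_disconnects (ideal_hulls R X) (ideal_space R X)"
  shows "\<exists>e. nontrivial_idempotent R e"
proof -
  interpret R: cring R by (fact assms(1))
  obtain I J where I: "ideal I R" and J: "ideal J R"
    and nonempty: "ideal_hull X I \<noteq> {}" "ideal_hull X J \<noteq> {}"
    and cover: "X = ideal_hull X I \<union> ideal_hull X J"
    and disjoint: "ideal_hull X I \<inter> ideal_hull X J = {}"
    using assms(5) unfolding strongly_disconnects_def ideal_hulls_def ideals_def by auto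
  have max_in_X: "M \<in> X" if "maximalideal M R" for M
    using that assms(4) unfolding max_ideals_def by blast
  obtain e f where e: "e \<in> I" and f: "f \<in> J" and one: "\<one>\<^bsub>R\<^esub> = e \<oplus>\<^bsub>R\<^esub> f"
  proof (rule R.comaximal_if_no_common_maximalideal[OF I J])
    show False if "maximalideal M R" "I \<subseteq> M" "J \<subseteq> M" for M
      using that max_in_X disjoint unfolding ideal_hull_def by blast
  qed
  have carr: "e \<in> carrier R" "f \<in> carrier R"
    using I J e f ideal.Icarr by metis+
  have "e \<otimes>\<^bsub>R\<^esub> f \<in> jacobson_radical R"
  proof (rule mult_in_jacobson_radical[OF I J e f])
    show "I \<subseteq> M \<or> J \<subseteq> M" if "maximalideal M R" for M
      using max_in_X[OF that] cover unfolding ideal_hull_def by blast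
  qed
  then have "e \<otimes>\<^bsub>R\<^esub> f = \<zero>\<^bsub>R\<^esub>"
    using assms(2) by simp
  then have "e \<otimes>\<^bsub>R\<^esub> e = e"
    by (rule R.complementary_orthogonal_imp_idempotent[OF carr one])
  moreover have "e \<noteq> \<one>\<^bsub>R\<^esub>" "f \<noteq> \<one>\<^bsub>R\<^esub>"
    using one_notin_ideal_if_hull_nonempty[OF assms(3)] nonempty e f by blast+
  moreover have "e \<noteq> \<zero>\<^bsub>R\<^esub>"
    using one carr \<open>f \<noteq> \<one>\<^bsub>R\<^esub>\<close> by auto
  ultimately show ?thesis
    using carr unfolding nontrivial_idempotent_def by blast
qed

end
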